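(* Let $R$ be a commutative ring with unity, $M$ an $R$-module, and $\Gamma$ a commutative cancellative monoid of finite type with Grothendieck group $G(\Gamma)$. Let $$\mathcal F^f(G(\Gamma),M):=\{f:G(\Gamma)\to M\;:\;\exists d\in\Gamma \text{ such that } \forall q\in G(\Gamma),\ f(q)\neq0\Rightarrow dq\in\Gamma\},$$ with $(f+g)(q):=f(q)+g(q)$ and, for $\alpha\in\mathcal F^f(G(\Gamma),R)$, $(\alpha\cdot f)(q):=\sum_{q'q''=q}\alpha(q')f(q'')$, for $q\in G(\Gamma)$. Then $\mathcal F^f(G(\Gamma),M)$ has, with these operations, a structure of an $\mathcal F^f(G(\Gamma),R)$-module. Moreover, the map $$i_*:\mathcal F(\Gamma,M)\to\mathcal F^f(G(\Gamma),M),\quad i_*(f)(q):=\begin{cases}f(q), & q\in\Gamma\\ 0, & q\notin\Gamma\end{cases}$$ is an injective morphism of $\mathcal F(\Gamma,R)$-modules.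
   Context: A monoid $(\Gamma,\cdot,1)$ is of finite type if for each $n\in\Gamma$ the set $\{(a,b)\in\Gamma\times\Gamma : n=ab\}$ is finite, and cancellative if $xy=xz$ implies $y=z$. The Grothendieck group $G(\Gamma)$ is the abelian group of fractions $\frac mn$ ($m,n\in\Gamma$), i.e. $\Gamma\times\Gamma$ modulo $(m,n)\sim(p,q)\Leftrightarrow mq=np$, with $\frac mn\cdot\frac{m'}{n'}=\frac{mm'}{nn'}$; $\Gamma$ is viewed as a subset of $G(\Gamma)$ via $n\mapsto\frac n1$. $\mathcal F(\Gamma,R)$ is the ring of all functions $\Gamma\to R$ under pointwise addition and $(\alpha\cdot\beta)(n)=\sum_{ab=n}\alpha(a)\beta(b)$; $\mathcal F(\Gamma,M)$ is the set of all functions $\Gamma\to M$, an $\mathcal F(\Gamma,R)$-module under pointwise addition and $(\alpha\cdot f)(n)=\sum_{ab=n}\alpha(a)f(b)$. $\mathcal F^f(G(\Gamma),R)$ is the set of $\alpha:G(\Gamma)\to R$ for which there is $d\in\Gamma$ such that $\alpha(q)\ne0\Rightarrow dq\in\Gamma$ for all $q\in G(\Gamma)$; it is a commutative ring with unity under pointwise addition and $(\alpha\cdot\beta)(q)=\sum_{q'q''=q}\alpha(q')\beta(q'')$, and it contains $\mathcal F(\Gamma,R)$ as a subring via extension of functions by zero outside $\Gamma$. Through this inclusion $\mathcal F^f(G(\Gamma),M)$ is regarded as an $\mathcal F(\Gamma,R)$-module. All sums over $q'q''=q$ range over pairs in $G(\Gamma)^2$ and have only finitely many nonzero terms. *)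

theory Defs
  imports "HOL-Algebra.Module" "HOL-Algebra.Divisibility"
begin

definition finite_type_monoid :: "('g, 'e) monoid_scheme \<Rightarrow> bool" where
  "finite_type_monoid \<Gamma> \<longleftrightarrow>
     (\<forall>n \<in> carrier \<Gamma>. finite {(a, b) \<in> carrier \<Gamma> \<times> carrier \<Gamma>. n = a \<otimes>\<^bsub>\<Gamma>\<^esub> b})"

definition groth_rel :: "('g, 'e) monoid_scheme \<Rightarrow> (('g \<times> 'g) \<times> ('g \<times> 'g)) set" where
  "groth_rel \<Gamma> = {((m, n), (p, q)). m \<in> carrier \<Gamma> \<and> n \<in> carrier \<Gamma> \<and> p \<in> carrier \<Gamma> \<and> q \<in> carrier \<Gamma>
     \<and> m \<otimes>\<^bsub>\<Gamma>\<^esub> q = n \<otimes>\<^bsub>\<Gamma>\<^esub> p}"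

definition groth_frac :: "('g, 'e) monoid_scheme \<Rightarrow> 'g \<Rightarrow> 'g \<Rightarrow> ('g \<times> 'g) set" where
  "groth_frac \<Gamma> m n = groth_rel \<Gamma> `` {(m, n)}"

text \<open>All sets in the union defining the product are equal, by \<open>groth_frac_mult\<close> below.\<close>

definition groth :: "('g, 'e) monoid_scheme \<Rightarrow> ('g \<times> 'g) set monoid" where
  "groth \<Gamma> = \<lparr>carrier = (carrier \<Gamma> \<times> carrier \<Gamma>) // groth_rel \<Gamma>,
     monoid.mult = (\<lambda>P Q. \<Union>(m, n) \<in> P. \<Union>(m', n') \<in> Q. groth_frac \<Gamma> (m \<otimes>\<^bsub>\<Gamma>\<^esub> m') (n \<otimes>\<^bsub>\<Gamma>\<^esub> n')),
     one = groth_frac \<Gamma> \<one>\<^bsub>\<Gamma>\<^esub> \<one>\<^bsub>\<Gamma>\<^esub>\<rparr>"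

definition groth_embed :: "('g, 'e) monoid_scheme \<Rightarrow> 'g \<Rightarrow> ('g \<times> 'g) set" where
  "groth_embed \<Gamma> n = groth_frac \<Gamma> n \<one>\<^bsub>\<Gamma>\<^esub>"

lemma groth_rel_iff:
  "((m, n), (p, q)) \<in> groth_rel \<Gamma> \<longleftrightarrow> m \<in> carrier \<Gamma> \<and> n \<in> carrier \<Gamma> \<and> p \<in> carrier \<Gamma> \<and> q \<in> carrier \<Gamma>
     \<and> m \<otimes>\<^bsub>\<Gamma>\<^esub> q = n \<otimes>\<^bsub>\<Gamma>\<^esub> p"
  by (simp add: groth_rel_def)

lemma equiv_groth_rel:
  assumes "comm_monoid_cancel \<Gamma>"
  shows "equiv (carrier \<Gamma> \<times> carrier \<Gamma>) (groth_rel \<Gamma>)"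
proof -
  interpret comm_monoid_cancel \<Gamma> by fact
  have tr: "((a, b), (e, f)) \<in> groth_rel \<Gamma>"
    if "((a, b), (c, d)) \<in> groth_rel \<Gamma>" "((c, d), (e, f)) \<in> groth_rel \<Gamma>" for a b c d e f
  proof -
    have c: "a \<in> carrier \<Gamma>" "b \<in> carrier \<Gamma>" "c \<in> carrier \<Gamma>" "d \<in> carrier \<Gamma>"
        "e \<in> carrier \<Gamma>" "f \<in> carrier \<Gamma>"
      and 1: "a \<otimes>\<^bsub>\<Gamma>\<^esub> d = b \<otimes>\<^bsub>\<Gamma>\<^esub> c" and 2: "c \<otimes>\<^bsub>\<Gamma>\<^esub> f = d \<otimes>\<^bsub>\<Gamma>\<^esub> e"
      using that by (auto simp: groth_rel_iff)
    have "d \<otimes>\<^bsub>\<Gamma>\<^esub> (a \<otimes>\<^bsub>\<Gamma>\<^esub> f) = (a \<otimes>\<^bsub>\<Gamma>\<^esub> d) \<otimes>\<^bsub>\<Gamma>\<^esub> f" using c by (simp add: m_ac)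
    also have "\<dots> = b \<otimes>\<^bsub>\<Gamma>\<^esub> (c \<otimes>\<^bsub>\<Gamma>\<^esub> f)" using c by (simp add: 1 m_assoc)
    also have "\<dots> = d \<otimes>\<^bsub>\<Gamma>\<^esub> (b \<otimes>\<^bsub>\<Gamma>\<^esub> e)" using c by (simp add: 2 m_ac)
    finally have "a \<otimes>\<^bsub>\<Gamma>\<^esub> f = b \<otimes>\<^bsub>\<Gamma>\<^esub> e" by (rule l_cancel) (use c in auto)
    then show ?thesis using c by (simp add: groth_rel_iff)
  qed
  show ?thesis
  proof (rule equivI)
    show "groth_rel \<Gamma> \<subseteq> (carrier \<Gamma> \<times> carrier \<Gamma>) \<times> (carrier \<Gamma> \<times> carrier \<Gamma>)"
      by (auto simp: groth_rel_def)
    show "refl_on (carrier \<Gamma> \<times> carrier \<Gamma>) (groth_rel \<Gamma>)"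
      by (auto simp: refl_on_def groth_rel_def m_comm)
    show "sym (groth_rel \<Gamma>)"
      by (auto simp: sym_def groth_rel_def m_comm)
    show "trans (groth_rel \<Gamma>)"
      by (rule transI) (use tr in \<open>metis prod.exhaust\<close>)
  qed
qed

lemma groth_frac_eq_iff:
  assumes "comm_monoid_cancel \<Gamma>"
    and "m \<in> carrier \<Gamma>" "n \<in> carrier \<Gamma>" "p \<in> carrier \<Gamma>" "q \<in> carrier \<Gamma>"
  shows "groth_frac \<Gamma> m n = groth_frac \<Gamma> p q \<longleftrightarrow> m \<otimes>\<^bsub>\<Gamma>\<^esub> q = n \<otimes>\<^bsub>\<Gamma>\<^esub> p"
  using eq_equiv_class_iff[OF equiv_groth_rel[OF assms(1)], of "(m, n)" "(p, q)"] assms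
  by (simp add: groth_frac_def groth_rel_iff)

lemma groth_frac_mult:
  assumes "comm_monoid_cancel \<Gamma>"
    and "m \<in> carrier \<Gamma>" "n \<in> carrier \<Gamma>" "m' \<in> carrier \<Gamma>" "n' \<in> carrier \<Gamma>"
  shows "groth_frac \<Gamma> m n \<otimes>\<^bsub>groth \<Gamma>\<^esub> groth_frac \<Gamma> m' n' = groth_frac \<Gamma> (m \<otimes>\<^bsub>\<Gamma>\<^esub> m') (n \<otimes>\<^bsub>\<Gamma>\<^esub> n')"
proof -
  interpret comm_monoid_cancel \<Gamma> by fact
  have eq: "groth_frac \<Gamma> (a \<otimes>\<^bsub>\<Gamma>\<^esub> a') (b \<otimes>\<^bsub>\<Gamma>\<^esub> b') = groth_frac \<Gamma> (m \<otimes>\<^bsub>\<Gamma>\<^esub> m') (n \<otimes>\<^bsub>\<Gamma>\<^esub> n')"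
    if "(a, b) \<in> groth_frac \<Gamma> m n" "(a', b') \<in> groth_frac \<Gamma> m' n'" for a b a' b'
  proof -
    have c: "a \<in> carrier \<Gamma>" "b \<in> carrier \<Gamma>" "a' \<in> carrier \<Gamma>" "b' \<in> carrier \<Gamma>"
      and 1: "m \<otimes>\<^bsub>\<Gamma>\<^esub> b = n \<otimes>\<^bsub>\<Gamma>\<^esub> a" and 2: "m' \<otimes>\<^bsub>\<Gamma>\<^esub> b' = n' \<otimes>\<^bsub>\<Gamma>\<^esub> a'"
      using that by (auto simp: groth_frac_def groth_rel_iff)
    have "(a \<otimes>\<^bsub>\<Gamma>\<^esub> a') \<otimes>\<^bsub>\<Gamma>\<^esub> (n \<otimes>\<^bsub>\<Gamma>\<^esub> n') = (n \<otimes>\<^bsub>\<Gamma>\<^esub> a) \<otimes>\<^bsub>\<Gamma>\<^esub> (n' \<otimes>\<^bsub>\<Gamma>\<^esub> a')"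
      using c assms by (simp add: m_ac)
    also have "\<dots> = (b \<otimes>\<^bsub>\<Gamma>\<^esub> b') \<otimes>\<^bsub>\<Gamma>\<^esub> (m \<otimes>\<^bsub>\<Gamma>\<^esub> m')"
      unfolding 1[symmetric] 2[symmetric] using c assms by (simp add: m_ac)
    finally show ?thesis using c assms by (subst groth_frac_eq_iff) auto
  qed
  have "(m, n) \<in> groth_frac \<Gamma> m n" "(m', n') \<in> groth_frac \<Gamma> m' n'"
    using assms by (auto simp: groth_frac_def groth_rel_iff m_comm)
  moreover have "groth_frac \<Gamma> m n \<otimes>\<^bsub>groth \<Gamma>\<^esub> groth_frac \<Gamma> m' n' =
      (\<Union>(a, b) \<in> groth_frac \<Gamma> m n. \<Union>(a', b') \<in> groth_frac \<Gamma> m' n'.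
        groth_frac \<Gamma> (a \<otimes>\<^bsub>\<Gamma>\<^esub> a') (b \<otimes>\<^bsub>\<Gamma>\<^esub> b'))"
    by (simp add: groth_def)
  moreover have "\<dots> = (\<Union>x \<in> groth_frac \<Gamma> m n. \<Union>y \<in> groth_frac \<Gamma> m' n'.
        groth_frac \<Gamma> (m \<otimes>\<^bsub>\<Gamma>\<^esub> m') (n \<otimes>\<^bsub>\<Gamma>\<^esub> n'))"
    using eq by (intro SUP_cong refl) auto
  ultimately show ?thesis by auto
qed

text \<open>\<open>finsum\<close> is zero on an infinite index set. The set of all pairs with product \<open>q\<close> is in
  general infinite when \<open>H\<close> is a group, so the sum runs over the pairs whose term is nonzero.
  The operation \<open>op\<close> is the multiplication of \<open>R\<close> when \<open>A = R\<close>, and the scalar multiplication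
  when \<open>A\<close> is an \<open>R\<close>-module.\<close>

definition convolution ::
  "('h, 'e) monoid_scheme \<Rightarrow> ('a, 'x) ring_scheme \<Rightarrow> ('r \<Rightarrow> 'a \<Rightarrow> 'a) \<Rightarrow> ('h \<Rightarrow> 'r) \<Rightarrow> ('h \<Rightarrow> 'a) \<Rightarrow> 'h \<Rightarrow> 'a"
  where
  "convolution H A op \<alpha> f = (\<lambda>q \<in> carrier H.
     finsum A (\<lambda>(q', q''). op (\<alpha> q') (f q''))
       {(q', q'') \<in> carrier H \<times> carrier H. q' \<otimes>\<^bsub>H\<^esub> q'' = q \<and> op (\<alpha> q') (f q'') \<noteq> \<zero>\<^bsub>A\<^esub>})"

definition fun_ring ::
  "('h, 'e) monoid_scheme \<Rightarrow> ('r, 'k) ring_scheme \<Rightarrow> ('h \<Rightarrow> 'r) set \<Rightarrow> ('h \<Rightarrow> 'r) ring" where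
  "fun_ring H R C = \<lparr>carrier = C,
     monoid.mult = convolution H R (monoid.mult R),
     one = (\<lambda>q \<in> carrier H. if q = \<one>\<^bsub>H\<^esub> then \<one>\<^bsub>R\<^esub> else \<zero>\<^bsub>R\<^esub>),
     zero = (\<lambda>q \<in> carrier H. \<zero>\<^bsub>R\<^esub>),
     add = (\<lambda>\<alpha> \<beta>. \<lambda>q \<in> carrier H. \<alpha> q \<oplus>\<^bsub>R\<^esub> \<beta> q)\<rparr>"

text \<open>The fields \<open>mult\<close> and \<open>one\<close> of a module record play no role in the locale \<open>module\<close>.\<close>

definition fun_module ::
  "('h, 'e) monoid_scheme \<Rightarrow> ('r, 'm, 'l) module_scheme \<Rightarrow> ('h \<Rightarrow> 'm) set \<Rightarrow> ('h \<Rightarrow> 'r, 'h \<Rightarrow> 'm) module" where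
  "fun_module H M C = \<lparr>carrier = C,
     monoid.mult = undefined,
     one = undefined,
     zero = (\<lambda>q \<in> carrier H. \<zero>\<^bsub>M\<^esub>),
     add = (\<lambda>f g. \<lambda>q \<in> carrier H. f q \<oplus>\<^bsub>M\<^esub> g q),
     smult = convolution H M (smult M)\<rparr>"

definition Ff_carrier ::
  "('g, 'e) monoid_scheme \<Rightarrow> ('a, 'x) ring_scheme \<Rightarrow> (('g \<times> 'g) set \<Rightarrow> 'a) set" where
  "Ff_carrier \<Gamma> A = {f \<in> carrier (groth \<Gamma>) \<rightarrow>\<^sub>E carrier A.
     \<exists>d \<in> carrier \<Gamma>. \<forall>q \<in> carrier (groth \<Gamma>).
       f q \<noteq> \<zero>\<^bsub>A\<^esub> \<longrightarrow> groth_embed \<Gamma> d \<otimes>\<^bsub>groth \<Gamma>\<^esub> q \<in> groth_embed \<Gamma> ` carrier \<Gamma>}"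

definition F_ring :: "('g, 'e) monoid_scheme \<Rightarrow> ('r, 'k) ring_scheme \<Rightarrow> ('g \<Rightarrow> 'r) ring" where
  "F_ring \<Gamma> R = fun_ring \<Gamma> R (carrier \<Gamma> \<rightarrow>\<^sub>E carrier R)"

definition F_module ::
  "('g, 'e) monoid_scheme \<Rightarrow> ('r, 'm, 'l) module_scheme \<Rightarrow> ('g \<Rightarrow> 'r, 'g \<Rightarrow> 'm) module" where
  "F_module \<Gamma> M = fun_module \<Gamma> M (carrier \<Gamma> \<rightarrow>\<^sub>E carrier M)"

definition Ff_ring ::
  "('g, 'e) monoid_scheme \<Rightarrow> ('r, 'k) ring_scheme \<Rightarrow> (('g \<times> 'g) set \<Rightarrow> 'r) ring" where
  "Ff_ring \<Gamma> R = fun_ring (groth \<Gamma>) R (Ff_carrier \<Gamma> R)"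

definition Ff_module ::
  "('g, 'e) monoid_scheme \<Rightarrow> ('r, 'm, 'l) module_scheme
     \<Rightarrow> (('g \<times> 'g) set \<Rightarrow> 'r, ('g \<times> 'g) set \<Rightarrow> 'm) module" where
  "Ff_module \<Gamma> M = fun_module (groth \<Gamma>) M (Ff_carrier \<Gamma> M)"

definition ext_zero ::
  "('g, 'e) monoid_scheme \<Rightarrow> ('a, 'x) ring_scheme \<Rightarrow> ('g \<Rightarrow> 'a) \<Rightarrow> ('g \<times> 'g) set \<Rightarrow> 'a" where
  "ext_zero \<Gamma> A f = (\<lambda>q \<in> carrier (groth \<Gamma>).
     if q \<in> groth_embed \<Gamma> ` carrier \<Gamma> then f (inv_into (carrier \<Gamma>) (groth_embed \<Gamma>) q) else \<zero>\<^bsub>A\<^esub>)"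

definition restrict_scalars :: "('s \<Rightarrow> 'r) \<Rightarrow> ('r, 'm) module \<Rightarrow> ('s, 'm) module" where
  "restrict_scalars \<phi> N = \<lparr>carrier = carrier N, monoid.mult = monoid.mult N, one = one N, zero = zero N,
     add = add N, smult = (\<lambda>a. smult N (\<phi> a))\<rparr>"

definition module_morphism ::
  "('r, 'k) ring_scheme \<Rightarrow> ('r, 'm, 'x) module_scheme \<Rightarrow> ('r, 'n, 'y) module_scheme \<Rightarrow> ('m \<Rightarrow> 'n) \<Rightarrow> bool"
  where
  "module_morphism R M N h \<longleftrightarrow> module R M \<and> module R N \<and>
     h \<in> carrier M \<rightarrow> carrier N \<and>
     (\<forall>x \<in> carrier M. \<forall>y \<in> carrier M. h (x \<oplus>\<^bsub>M\<^esub> y) = h x \<oplus>\<^bsub>N\<^esub> h y) \<and>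
     (\<forall>a \<in> carrier R. \<forall>x \<in> carrier M. h (a \<odot>\<^bsub>M\<^esub> x) = a \<odot>\<^bsub>N\<^esub> h x)"

end

theory Submission
  imports Defs
begin

text \<open>The module axioms for convolution hold whenever the supports of the functions range over an
  ideal of subsets of a commutative monoid \<open>H\<close> that contains \<open>{\<one>}\<close>, is closed under products
  of sets, and is such that each element of \<open>H\<close> has only finitely many factorisations \<open>ab\<close> with
  \<open>a\<close> and \<open>b\<close> in two given members of the ideal. Over such a family each convolution is a sum over
  an explicit finite set of pairs (\<open>convolution_eq\<close>), and associativity is a regrouping of a finite
  sum over triples (\<open>convolution_assoc\<close>). The ring of scalar functions is the case in which the
  module is the ring itself, so \<open>module_fun_module\<close> and \<open>cring_fun_ring\<close> rest on the same
  computations.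

  Two families are of this kind: all subsets of a cancellative monoid \<open>\<Gamma>\<close> of finite type, and the
  sets of fractions that have a common denominator in \<open>\<Gamma>\<close>. In the second case, if \<open>d\<close> and \<open>e\<close> are
  denominators of \<open>S\<close> and \<open>T\<close>, then a factorisation \<open>q = ab\<close> with \<open>a \<in> S\<close>, \<open>b \<in> T\<close> gives the
  factorisation \<open>deq = (da)(eb)\<close> inside \<open>\<Gamma>\<close>, and this is injective in \<open>(a, b)\<close>; finite type
  bounds the number of the latter (\<open>finite_factor_pairs_common_denom\<close>).

  The embedding of \<open>\<Gamma>\<close> in its group of fractions is an injective homomorphism, so the factorisations
  of \<open>n \<in> \<Gamma>\<close> are exactly the factorisations of its image into images, and no element outside the
  image is a product of images. Hence extension by zero commutes with convolution
  (\<open>ext_zero_convolution\<close>). For scalars this gives a ring homomorphism, along which the module of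
  functions on fractions becomes a module over the functions on \<open>\<Gamma>\<close>, and for module-valued
  functions it gives linearity.\<close>

section \<open>Finite sums\<close>

lemma (in comm_monoid) finprod_fibres:
  assumes "finite T" "finite I" "\<phi> \<in> T \<rightarrow> I" "g \<in> T \<rightarrow> carrier G"
  shows "finprod G (\<lambda>i. finprod G g {t \<in> T. \<phi> t = i}) I = finprod G g T"
proof -
  have "T = (\<Union>i\<in>I. {t \<in> T. \<phi> t = i})" using assms(3) by auto
  then have "finprod G g T = finprod G g (\<Union>i\<in>I. {t \<in> T. \<phi> t = i})" by simp
  also have "\<dots> = finprod G (\<lambda>i. finprod G g {t \<in> T. \<phi> t = i}) I"
    by (rule finprod_UN_disjoint) (use assms in \<open>auto simp: pairwise_def disjnt_def\<close>)
  finally show ?thesis by simp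
qed

lemma (in module) finsum_smult_rdistr:
  assumes "finite A" "f \<in> A \<rightarrow> carrier R" "x \<in> carrier M"
  shows "finsum R f A \<odot>\<^bsub>M\<^esub> x = (\<Oplus>\<^bsub>M\<^esub>i\<in>A. f i \<odot>\<^bsub>M\<^esub> x)"
  using assms
proof (induct set: finite)
  case (insert a A)
  then have "f a \<in> carrier R" "f \<in> A \<rightarrow> carrier R" by auto
  with insert show ?case
    by (simp add: Pi_def smult_l_distr R.finsum_closed)
qed simp

text \<open>A ring regarded as a module over itself. It has the same additive structure, hence the same
  finite sums, so that every statement about the convolution of a scalar function with a
  module-valued function specialises to the convolution of two scalar functions.\<close>

definition regular_module :: "('r, 'k) ring_scheme \<Rightarrow> ('r, 'r) module" where
  "regular_module R = \<lparr>carrier = carrier R, monoid.mult = monoid.mult R, one = one R,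
     zero = zero R, add = add R, smult = monoid.mult R\<rparr>"

lemma regular_module_simps [simp]:
  "carrier (regular_module R) = carrier R" "zero (regular_module R) = zero R"
  "add (regular_module R) = add R" "smult (regular_module R) = monoid.mult R"
  by (simp_all add: regular_module_def)

lemma finsum_regular_module [simp]: "finsum (regular_module R) f A = finsum R f A"
  by (simp add: finsum_def finprod_def)

lemma (in cring) module_regular_module: "module R (regular_module R)"
proof (rule moduleI)
  show "abelian_group (regular_module R)"
    by (rule abelian_groupI) (auto simp: a_assoc intro: a_comm l_neg)
qed (auto simp: l_distr r_distr m_assoc is_cring)

lemma convolution_regular_module [simp]:
  "convolution H (regular_module R) op = convolution H R op"
  by (simp add: convolution_def fun_eq_iff)

section \<open>Convolution\<close>

text \<open>The restriction to \<open>carrier H\<close> matters because a function is \<open>undefined\<close>, possibly nonzero,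
  elsewhere.\<close>

definition support :: "('h, 'e) monoid_scheme \<Rightarrow> ('a, 'x) ring_scheme \<Rightarrow> ('h \<Rightarrow> 'a) \<Rightarrow> 'h set" where
  "support H A f = {q \<in> carrier H. f q \<noteq> \<zero>\<^bsub>A\<^esub>}"

text \<open>The factorisations of \<open>q\<close> with one factor in \<open>S\<close> and the other in \<open>T\<close>.\<close>

definition factor_pairs :: "('h, 'e) monoid_scheme \<Rightarrow> 'h set \<Rightarrow> 'h set \<Rightarrow> 'h \<Rightarrow> ('h \<times> 'h) set" where
  "factor_pairs H S T q = {(a, b) \<in> S \<times> T. a \<otimes>\<^bsub>H\<^esub> b = q}"

lemma support_regular_module [simp]: "support H (regular_module R) = support H R"
  by (simp add: support_def fun_eq_iff)

text \<open>A convolution may be computed over any finite set of factorisations of \<open>q\<close> that contains those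
  with both factors in the supports. Its defining set of pairs, cut out by nonzero terms, is smaller
  and depends on the functions, which makes it unsuitable for comparing sums.\<close>

lemma convolution_eq_finsum:
  assumes "module R M"
    and \<alpha>: "\<alpha> \<in> carrier H \<rightarrow> carrier R" and f: "f \<in> carrier H \<rightarrow> carrier M"
    and q: "q \<in> carrier H" and P: "finite P" "P \<subseteq> factor_pairs H (carrier H) (carrier H) q"
    and supp: "factor_pairs H (support H R \<alpha>) (support H M f) q \<subseteq> P"
  shows "convolution H M (smult M) \<alpha> f q = finsum M (\<lambda>(a, b). \<alpha> a \<odot>\<^bsub>M\<^esub> f b) P"
proof -
  interpret module R M by fact
  have closed: "\<alpha> a \<in> carrier R" "f a \<in> carrier M" if "a \<in> carrier H" for a
    using that \<alpha> f by auto
  let ?N = "{(a, b) \<in> carrier H \<times> carrier H. a \<otimes>\<^bsub>H\<^esub> b = q \<and> \<alpha> a \<odot>\<^bsub>M\<^esub> f b \<noteq> \<zero>\<^bsub>M\<^esub>}"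
  have sub: "?N \<subseteq> P"
  proof safe
    fix a b assume ab: "a \<in> carrier H" "b \<in> carrier H" "\<alpha> a \<odot>\<^bsub>M\<^esub> f b \<noteq> \<zero>\<^bsub>M\<^esub>" "q = a \<otimes>\<^bsub>H\<^esub> b"
    then have "\<alpha> a \<noteq> \<zero>\<^bsub>R\<^esub>" "f b \<noteq> \<zero>\<^bsub>M\<^esub>" using closed by auto
    then show "(a, b) \<in> P" using ab supp by (auto simp: support_def factor_pairs_def)
  qed
  show ?thesis
    unfolding convolution_def restrict_apply'[OF q]
    by (rule M.add.finprod_mono_neutral_cong_left[OF P(1) sub])
      (use P closed in \<open>auto simp: factor_pairs_def subset_iff\<close>)
qed

section \<open>Rings and modules of functions with restricted supports\<close>

text \<open>A family of sets that may serve as supports: an ideal of subsets of \<open>H\<close>, closed under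
  products, in which every product set has finite fibres. The functions supported in such a family
  form a ring, respectively a module, under convolution.\<close>

locale support_family = comm_monoid H for H (structure) +
  fixes K :: "'a set set"
  assumes subset_carrier: "S \<in> K \<Longrightarrow> S \<subseteq> carrier H"
    and subset_mem: "S \<in> K \<Longrightarrow> T \<subseteq> S \<Longrightarrow> T \<in> K"
    and Un_mem: "S \<in> K \<Longrightarrow> T \<in> K \<Longrightarrow> S \<union> T \<in> K"
    and one_mem: "{\<one>} \<in> K"
    and product_mem: "S \<in> K \<Longrightarrow> T \<in> K \<Longrightarrow> (\<lambda>(a, b). a \<otimes> b) ` (S \<times> T) \<in> K"
    and finite_factor_pairs: "S \<in> K \<Longrightarrow> T \<in> K \<Longrightarrow> q \<in> carrier H \<Longrightarrow> finite (factor_pairs H S T q)"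
begin

text \<open>The functions with support in the family, in the encoding by functions that are
  \<open>undefined\<close> outside \<open>carrier H\<close>.\<close>

definition fun_carrier :: "('c, 'x) ring_scheme \<Rightarrow> ('a \<Rightarrow> 'c) set" where
  "fun_carrier A = {f \<in> carrier H \<rightarrow>\<^sub>E carrier A. support H A f \<in> K}"

lemma fun_carrier_regular_module [simp]: "fun_carrier (regular_module R) = fun_carrier R"
  by (simp add: fun_carrier_def)

lemma fun_carrierD:
  assumes "f \<in> fun_carrier A"
  shows "f \<in> carrier H \<rightarrow> carrier A" "f \<in> extensional (carrier H)" "support H A f \<in> K"
    and "\<And>q. q \<in> carrier H \<Longrightarrow> f q \<in> carrier A"
  using assms by (auto simp: fun_carrier_def PiE_def)

lemma fun_carrierI:
  assumes "f \<in> extensional (carrier H)" "\<And>q. q \<in> carrier H \<Longrightarrow> f q \<in> carrier A"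
    and "S \<in> K" "support H A f \<subseteq> S"
  shows "f \<in> fun_carrier A"
  using assms subset_mem by (auto simp: fun_carrier_def PiE_def)

lemma convolution_extensional: "convolution H A op \<alpha> f \<in> extensional (carrier H)"
  by (simp add: convolution_def)

lemma zero_fun_carrier:
  assumes "abelian_group A"
  shows "(\<lambda>q\<in>carrier H. \<zero>\<^bsub>A\<^esub>) \<in> fun_carrier A"
proof -
  interpret abelian_group A by fact
  show ?thesis by (rule fun_carrierI[OF _ _ one_mem]) (auto simp: support_def)
qed

lemma add_fun_carrier:
  assumes "abelian_group A" and f: "f \<in> fun_carrier A" and g: "g \<in> fun_carrier A"
  shows "(\<lambda>q\<in>carrier H. f q \<oplus>\<^bsub>A\<^esub> g q) \<in> fun_carrier A"
proof -
  interpret abelian_group A by fact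
  show ?thesis
    by (rule fun_carrierI[OF _ _ Un_mem[OF fun_carrierD(3)[OF f] fun_carrierD(3)[OF g]]])
      (use fun_carrierD(4)[OF f] fun_carrierD(4)[OF g] in \<open>auto simp: support_def\<close>)
qed

text \<open>Stated for an arbitrary record \<open>G\<close> with pointwise addition, so that it covers both the ring and
  the module of functions.\<close>

lemma abelian_group_fun_carrier:
  assumes "abelian_group A" and G: "carrier G = fun_carrier A"
    "add G = (\<lambda>f g. \<lambda>q\<in>carrier H. f q \<oplus>\<^bsub>A\<^esub> g q)" "zero G = (\<lambda>q\<in>carrier H. \<zero>\<^bsub>A\<^esub>)"
  shows "abelian_group G"
proof -
  interpret abelian_group A by fact
  show ?thesis
  proof (rule abelian_groupI; unfold G)
    fix f assume f: "f \<in> fun_carrier A"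
    show "(\<lambda>q\<in>carrier H. (\<lambda>q\<in>carrier H. \<zero>\<^bsub>A\<^esub>) q \<oplus>\<^bsub>A\<^esub> f q) = f"
      by (rule extensionalityI) (use fun_carrierD[OF f] in auto)
    let ?g = "\<lambda>q\<in>carrier H. \<ominus>\<^bsub>A\<^esub> f q"
    have "?g \<in> fun_carrier A"
      by (rule fun_carrierI[OF _ _ fun_carrierD(3)[OF f]])
        (use fun_carrierD(4)[OF f] in \<open>auto simp: support_def\<close>)
    moreover have "(\<lambda>q\<in>carrier H. ?g q \<oplus>\<^bsub>A\<^esub> f q) = (\<lambda>q\<in>carrier H. \<zero>\<^bsub>A\<^esub>)"
      by (rule restrict_ext) (use fun_carrierD(4)[OF f] in \<open>auto simp: l_neg\<close>)
    ultimately show "\<exists>g\<in>fun_carrier A. (\<lambda>q\<in>carrier H. g q \<oplus>\<^bsub>A\<^esub> f q) = (\<lambda>q\<in>carrier H. \<zero>\<^bsub>A\<^esub>)"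
      by blast
  qed (auto intro!: restrict_ext intro: a_comm
      simp: zero_fun_carrier add_fun_carrier \<open>abelian_group A\<close> fun_carrierD(4) a_assoc)
qed

lemma convolution_eq:
  assumes "module R M" and \<alpha>: "\<alpha> \<in> fun_carrier R" and f: "f \<in> fun_carrier M"
    and "S \<in> K" "T \<in> K" "support H R \<alpha> \<subseteq> S" "support H M f \<subseteq> T" "q \<in> carrier H"
  shows "convolution H M (smult M) \<alpha> f q = finsum M (\<lambda>(a, b). \<alpha> a \<odot>\<^bsub>M\<^esub> f b) (factor_pairs H S T q)"
  by (rule convolution_eq_finsum[OF assms(1) fun_carrierD(1)[OF \<alpha>] fun_carrierD(1)[OF f]])
    (use assms finite_factor_pairs subset_carrier in \<open>auto simp: factor_pairs_def subset_iff\<close>)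

lemma ring_convolution_eq:
  assumes "cring R" "\<alpha> \<in> fun_carrier R" "\<beta> \<in> fun_carrier R"
    and "S \<in> K" "T \<in> K" "support H R \<alpha> \<subseteq> S" "support H R \<beta> \<subseteq> T" "q \<in> carrier H"
  shows "convolution H R (monoid.mult R) \<alpha> \<beta> q =
    finsum R (\<lambda>(a, b). \<alpha> a \<otimes>\<^bsub>R\<^esub> \<beta> b) (factor_pairs H S T q)"
  using convolution_eq[OF cring.module_regular_module[OF assms(1)], of \<alpha> \<beta> S T q] assms by simp

lemma convolution_closed:
  assumes "module R M" and \<alpha>: "\<alpha> \<in> fun_carrier R" and f: "f \<in> fun_carrier M"
  shows "convolution H M (smult M) \<alpha> f \<in> fun_carrier M"
    and "support H M (convolution H M (smult M) \<alpha> f) \<subseteq>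
      (\<lambda>(a, b). a \<otimes> b) ` (support H R \<alpha> \<times> support H M f)"
proof -
  interpret module R M by fact
  let ?S = "support H R \<alpha>" and ?T = "support H M f"
  let ?c = "convolution H M (smult M) \<alpha> f"
  note K = fun_carrierD(3)[OF \<alpha>] fun_carrierD(3)[OF f]
  note eq = convolution_eq[OF assms K subset_refl subset_refl]
  show supp: "support H M ?c \<subseteq> (\<lambda>(a, b). a \<otimes> b) ` (?S \<times> ?T)"
  proof
    fix q assume "q \<in> support H M ?c"
    then have q: "q \<in> carrier H" "?c q \<noteq> \<zero>\<^bsub>M\<^esub>" by (auto simp: support_def)
    have "factor_pairs H ?S ?T q \<noteq> {}"
    proof
      assume "factor_pairs H ?S ?T q = {}"
      with eq[OF q(1)] q(2) show False by simp
    qed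
    then show "q \<in> (\<lambda>(a, b). a \<otimes> b) ` (?S \<times> ?T)" by (force simp: factor_pairs_def)
  qed
  show "?c \<in> fun_carrier M"
  proof (rule fun_carrierI[OF convolution_extensional _ product_mem[OF K] supp])
    fix q assume "q \<in> carrier H"
    then show "?c q \<in> carrier M"
      unfolding eq[OF \<open>q \<in> carrier H\<close>]
      by (intro M.finsum_closed)
        (use fun_carrierD(4)[OF \<alpha>] fun_carrierD(4)[OF f] in \<open>auto simp: factor_pairs_def support_def\<close>)
  qed
qed

lemma ring_convolution_closed:
  assumes "cring R" and \<alpha>: "\<alpha> \<in> fun_carrier R" and \<beta>: "\<beta> \<in> fun_carrier R"
  shows "convolution H R (monoid.mult R) \<alpha> \<beta> \<in> fun_carrier R"
    and "support H R (convolution H R (monoid.mult R) \<alpha> \<beta>) \<subseteq>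
      (\<lambda>(a, b). a \<otimes> b) ` (support H R \<alpha> \<times> support H R \<beta>)"
  using convolution_closed[OF cring.module_regular_module[OF assms(1)], of \<alpha> \<beta>] assms by simp_all

lemma convolution_add_left:
  assumes "module R M" and \<alpha>: "\<alpha> \<in> fun_carrier R" and \<beta>: "\<beta> \<in> fun_carrier R"
    and f: "f \<in> fun_carrier M"
  shows "convolution H M (smult M) (\<lambda>q\<in>carrier H. \<alpha> q \<oplus>\<^bsub>R\<^esub> \<beta> q) f =
    (\<lambda>q\<in>carrier H. convolution H M (smult M) \<alpha> f q \<oplus>\<^bsub>M\<^esub> convolution H M (smult M) \<beta> f q)"
proof (rule extensionalityI)
  interpret module R M by fact
  let ?S = "support H R \<alpha> \<union> support H R \<beta>" and ?T = "support H M f"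
  have K: "?S \<in> K" "?T \<in> K" using \<alpha> \<beta> f by (auto intro: Un_mem fun_carrierD(3))
  fix q assume q: "q \<in> carrier H"
  note closed = fun_carrierD(4)[OF \<alpha>] fun_carrierD(4)[OF \<beta>] fun_carrierD(4)[OF f]
  have sum_closed: "(\<lambda>q\<in>carrier H. \<alpha> q \<oplus>\<^bsub>R\<^esub> \<beta> q) \<in> fun_carrier R"
    using add_fun_carrier[OF R.is_abelian_group \<alpha> \<beta>] .
  have supp: "support H R (\<lambda>q\<in>carrier H. \<alpha> q \<oplus>\<^bsub>R\<^esub> \<beta> q) \<subseteq> ?S"
    by (auto simp: support_def)
  have "convolution H M (smult M) (\<lambda>q\<in>carrier H. \<alpha> q \<oplus>\<^bsub>R\<^esub> \<beta> q) f q =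
      finsum M (\<lambda>(a, b). (\<lambda>q\<in>carrier H. \<alpha> q \<oplus>\<^bsub>R\<^esub> \<beta> q) a \<odot>\<^bsub>M\<^esub> f b) (factor_pairs H ?S ?T q)"
    by (rule convolution_eq[OF assms(1) sum_closed f K supp subset_refl q])
  also have "\<dots> = (\<Oplus>\<^bsub>M\<^esub>p\<in>factor_pairs H ?S ?T q.
      (case p of (a, b) \<Rightarrow> \<alpha> a \<odot>\<^bsub>M\<^esub> f b) \<oplus>\<^bsub>M\<^esub> (case p of (a, b) \<Rightarrow> \<beta> a \<odot>\<^bsub>M\<^esub> f b))"
    by (rule M.finsum_cong') (auto simp: smult_l_distr factor_pairs_def support_def closed)
  also have "\<dots> = (finsum M (\<lambda>(a, b). \<alpha> a \<odot>\<^bsub>M\<^esub> f b) (factor_pairs H ?S ?T q)) \<oplus>\<^bsub>M\<^esub>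
      (finsum M (\<lambda>(a, b). \<beta> a \<odot>\<^bsub>M\<^esub> f b) (factor_pairs H ?S ?T q))"
    by (rule M.finsum_addf) (auto simp: factor_pairs_def support_def closed)
  also have "\<dots> = convolution H M (smult M) \<alpha> f q \<oplus>\<^bsub>M\<^esub> convolution H M (smult M) \<beta> f q"
    using convolution_eq[OF assms(1) \<alpha> f K _ subset_refl q]
      convolution_eq[OF assms(1) \<beta> f K _ subset_refl q] by simp
  finally show "convolution H M (smult M) (\<lambda>q\<in>carrier H. \<alpha> q \<oplus>\<^bsub>R\<^esub> \<beta> q) f q =
    (\<lambda>q\<in>carrier H. convolution H M (smult M) \<alpha> f q \<oplus>\<^bsub>M\<^esub> convolution H M (smult M) \<beta> f q) q"
    using q by simp
qed (auto simp: convolution_extensional)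

lemma convolution_add_right:
  assumes "module R M" and \<alpha>: "\<alpha> \<in> fun_carrier R" and f: "f \<in> fun_carrier M"
    and g: "g \<in> fun_carrier M"
  shows "convolution H M (smult M) \<alpha> (\<lambda>q\<in>carrier H. f q \<oplus>\<^bsub>M\<^esub> g q) =
    (\<lambda>q\<in>carrier H. convolution H M (smult M) \<alpha> f q \<oplus>\<^bsub>M\<^esub> convolution H M (smult M) \<alpha> g q)"
proof (rule extensionalityI)
  interpret module R M by fact
  let ?S = "support H R \<alpha>" and ?T = "support H M f \<union> support H M g"
  have K: "?S \<in> K" "?T \<in> K" using \<alpha> f g by (auto intro: Un_mem fun_carrierD(3))
  fix q assume q: "q \<in> carrier H"
  note closed = fun_carrierD(4)[OF \<alpha>] fun_carrierD(4)[OF f] fun_carrierD(4)[OF g]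
  have sum_closed: "(\<lambda>q\<in>carrier H. f q \<oplus>\<^bsub>M\<^esub> g q) \<in> fun_carrier M"
    using add_fun_carrier[OF M.abelian_group_axioms f g] .
  have supp: "support H M (\<lambda>q\<in>carrier H. f q \<oplus>\<^bsub>M\<^esub> g q) \<subseteq> ?T"
    by (auto simp: support_def)
  have "convolution H M (smult M) \<alpha> (\<lambda>q\<in>carrier H. f q \<oplus>\<^bsub>M\<^esub> g q) q =
      finsum M (\<lambda>(a, b). \<alpha> a \<odot>\<^bsub>M\<^esub> (\<lambda>q\<in>carrier H. f q \<oplus>\<^bsub>M\<^esub> g q) b) (factor_pairs H ?S ?T q)"
    by (rule convolution_eq[OF assms(1) \<alpha> sum_closed K subset_refl supp q])
  also have "\<dots> = (\<Oplus>\<^bsub>M\<^esub>p\<in>factor_pairs H ?S ?T q.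
      (case p of (a, b) \<Rightarrow> \<alpha> a \<odot>\<^bsub>M\<^esub> f b) \<oplus>\<^bsub>M\<^esub> (case p of (a, b) \<Rightarrow> \<alpha> a \<odot>\<^bsub>M\<^esub> g b))"
    by (rule M.finsum_cong') (auto simp: smult_r_distr factor_pairs_def support_def closed)
  also have "\<dots> = (finsum M (\<lambda>(a, b). \<alpha> a \<odot>\<^bsub>M\<^esub> f b) (factor_pairs H ?S ?T q)) \<oplus>\<^bsub>M\<^esub>
      (finsum M (\<lambda>(a, b). \<alpha> a \<odot>\<^bsub>M\<^esub> g b) (factor_pairs H ?S ?T q))"
    by (rule M.finsum_addf) (auto simp: factor_pairs_def support_def closed)
  also have "\<dots> = convolution H M (smult M) \<alpha> f q \<oplus>\<^bsub>M\<^esub> convolution H M (smult M) \<alpha> g q"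
    using convolution_eq[OF assms(1) \<alpha> f K subset_refl _ q]
      convolution_eq[OF assms(1) \<alpha> g K subset_refl _ q] by simp
  finally show "convolution H M (smult M) \<alpha> (\<lambda>q\<in>carrier H. f q \<oplus>\<^bsub>M\<^esub> g q) q =
    (\<lambda>q\<in>carrier H. convolution H M (smult M) \<alpha> f q \<oplus>\<^bsub>M\<^esub> convolution H M (smult M) \<alpha> g q) q"
    using q by simp
qed (auto simp: convolution_extensional)

text \<open>Both iterated convolutions are the sum of \<open>\<alpha> a \<odot> (\<beta> b \<odot> f c)\<close> over the finitely many
  triples with product \<open>q\<close>: the sum is grouped by \<open>(a \<otimes> b, c)\<close> on one side and by
  \<open>(a, b \<otimes> c)\<close> on the other.\<close>

lemma convolution_assoc:
  assumes "module R M" and \<alpha>: "\<alpha> \<in> fun_carrier R" and \<beta>: "\<beta> \<in> fun_carrier R"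
    and f: "f \<in> fun_carrier M"
  shows "convolution H M (smult M) (convolution H R (monoid.mult R) \<alpha> \<beta>) f =
    convolution H M (smult M) \<alpha> (convolution H M (smult M) \<beta> f)"
proof (rule extensionalityI[OF convolution_extensional convolution_extensional])
  \<comment> \<open>After the interpretation, \<open>m_assoc\<close> names the associativity of \<open>R\<close>.\<close>
  note H_assoc = m_assoc
  interpret module R M by fact
  define S T U where "S = support H R \<alpha>" and "T = support H R \<beta>" and "U = support H M f"
  define ST TU where "ST = (\<lambda>(a, b). a \<otimes> b) ` (S \<times> T)" and "TU = (\<lambda>(a, b). a \<otimes> b) ` (T \<times> U)"
  have K: "S \<in> K" "T \<in> K" "U \<in> K" and K2: "ST \<in> K" "TU \<in> K"
    using \<alpha> \<beta> f product_mem by (auto simp: S_def T_def U_def ST_def TU_def fun_carrierD(3))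
  note sub = K[THEN subset_carrier, THEN subsetD] K2[THEN subset_carrier, THEN subsetD]
  fix q assume q: "q \<in> carrier H"
  define Tr where "Tr = {(a, b, c). a \<in> S \<and> b \<in> T \<and> c \<in> U \<and> (a \<otimes> b) \<otimes> c = q}"
  define g where "g = (\<lambda>(a, b, c). \<alpha> a \<odot>\<^bsub>M\<^esub> (\<beta> b \<odot>\<^bsub>M\<^esub> f c))"
  have closed: "\<And>a. a \<in> S \<Longrightarrow> \<alpha> a \<in> carrier R" "\<And>b. b \<in> T \<Longrightarrow> \<beta> b \<in> carrier R"
      "\<And>c. c \<in> U \<Longrightarrow> f c \<in> carrier M"
    using sub \<alpha> \<beta> f by (auto simp: fun_carrierD(4))
  have "Tr \<subseteq> (\<Union>(u, c)\<in>factor_pairs H ST U q. (\<lambda>(a, b). (a, b, c)) ` factor_pairs H S T u)"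
    by (force simp: Tr_def factor_pairs_def ST_def)
  moreover have "finite \<dots>"
  proof (rule finite_UN_I[OF finite_factor_pairs[OF K2(1) K(3) q]], clarify)
    fix u c assume "(u, c) \<in> factor_pairs H ST U q"
    then have "u \<in> carrier H" using sub by (simp add: factor_pairs_def)
    then show "finite ((\<lambda>(a, b). (a, b, c)) ` factor_pairs H S T u)"
      using finite_factor_pairs[OF K(1,2)] by simp
  qed
  ultimately have fin: "finite Tr" by (rule finite_subset)
  have assoc: "a \<otimes> b \<otimes> c = a \<otimes> (b \<otimes> c)" if "a \<in> S" "b \<in> T" "c \<in> U" for a b c
    using that sub by (simp add: H_assoc)
  have g: "g \<in> Tr \<rightarrow> carrier M" using closed by (auto simp: g_def Tr_def)

  have left: "convolution H R (monoid.mult R) \<alpha> \<beta> u \<odot>\<^bsub>M\<^esub> f c =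
      finsum M g {t \<in> Tr. (\<lambda>(a, b, c). (a \<otimes> b, c)) t = (u, c)}"
    if "(u, c) \<in> factor_pairs H ST U q" for u c
  proof -
    have uc: "u \<in> ST" "c \<in> U" "u \<otimes> c = q" using that by (auto simp: factor_pairs_def)
    have fib: "{t \<in> Tr. (\<lambda>(a, b, c). (a \<otimes> b, c)) t = (u, c)} =
        (\<lambda>(a, b). (a, b, c)) ` factor_pairs H S T u"
      using uc by (force simp: Tr_def factor_pairs_def)
    have "convolution H R (monoid.mult R) \<alpha> \<beta> u \<odot>\<^bsub>M\<^esub> f c =
        (\<Oplus>\<^bsub>R\<^esub>p\<in>factor_pairs H S T u. case p of (a, b) \<Rightarrow> \<alpha> a \<otimes>\<^bsub>R\<^esub> \<beta> b) \<odot>\<^bsub>M\<^esub> f c"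
      using ring_convolution_eq[OF R.is_cring \<alpha> \<beta> K(1,2)] uc sub by (simp add: S_def T_def)
    also have "\<dots> = (\<Oplus>\<^bsub>M\<^esub>p\<in>factor_pairs H S T u. (case p of (a, b) \<Rightarrow> \<alpha> a \<otimes>\<^bsub>R\<^esub> \<beta> b) \<odot>\<^bsub>M\<^esub> f c)"
      by (rule finsum_smult_rdistr[OF finite_factor_pairs[OF K(1,2)]])
        (use uc sub closed in \<open>auto simp: factor_pairs_def\<close>)
    also have "\<dots> = (\<Oplus>\<^bsub>M\<^esub>p\<in>factor_pairs H S T u. g ((\<lambda>(a, b). (a, b, c)) p))"
      by (rule M.finsum_cong') (use uc closed in \<open>auto simp: g_def factor_pairs_def smult_assoc1\<close>)
    also have "\<dots> = finsum M g ((\<lambda>(a, b). (a, b, c)) ` factor_pairs H S T u)"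
      by (rule M.finsum_reindex[symmetric])
        (use uc closed in \<open>auto simp: g_def factor_pairs_def inj_on_def\<close>)
    finally show ?thesis using fib by simp
  qed

  have right: "\<alpha> a \<odot>\<^bsub>M\<^esub> convolution H M (smult M) \<beta> f v =
      finsum M g {t \<in> Tr. (\<lambda>(a, b, c). (a, b \<otimes> c)) t = (a, v)}"
    if "(a, v) \<in> factor_pairs H S TU q" for a v
  proof -
    have av: "a \<in> S" "v \<in> TU" "a \<otimes> v = q" using that by (auto simp: factor_pairs_def)
    have fib: "{t \<in> Tr. (\<lambda>(a, b, c). (a, b \<otimes> c)) t = (a, v)} = Pair a ` factor_pairs H T U v"
      using av by (auto simp: Tr_def factor_pairs_def assoc)
    have "\<alpha> a \<odot>\<^bsub>M\<^esub> convolution H M (smult M) \<beta> f v =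
        \<alpha> a \<odot>\<^bsub>M\<^esub> (\<Oplus>\<^bsub>M\<^esub>p\<in>factor_pairs H T U v. case p of (b, c) \<Rightarrow> \<beta> b \<odot>\<^bsub>M\<^esub> f c)"
      using convolution_eq[OF assms(1) \<beta> f K(2,3)] av sub by (simp add: T_def U_def)
    also have "\<dots> = (\<Oplus>\<^bsub>M\<^esub>p\<in>factor_pairs H T U v. \<alpha> a \<odot>\<^bsub>M\<^esub> (case p of (b, c) \<Rightarrow> \<beta> b \<odot>\<^bsub>M\<^esub> f c))"
      by (rule finsum_smult_ldistr[OF finite_factor_pairs[OF K(2,3)]])
        (use av sub closed in \<open>auto simp: factor_pairs_def\<close>)
    also have "\<dots> = (\<Oplus>\<^bsub>M\<^esub>p\<in>factor_pairs H T U v. g (Pair a p))"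
      by (rule M.finsum_cong') (use av closed in \<open>auto simp: g_def factor_pairs_def\<close>)
    also have "\<dots> = finsum M g (Pair a ` factor_pairs H T U v)"
      by (rule M.finsum_reindex[symmetric])
        (use av closed in \<open>auto simp: g_def factor_pairs_def inj_on_def\<close>)
    finally show ?thesis using fib by simp
  qed

  have "convolution H M (smult M) (convolution H R (monoid.mult R) \<alpha> \<beta>) f q =
      finsum M (\<lambda>(u, c). convolution H R (monoid.mult R) \<alpha> \<beta> u \<odot>\<^bsub>M\<^esub> f c) (factor_pairs H ST U q)"
    using convolution_eq[OF assms(1) ring_convolution_closed(1)[OF R.is_cring \<alpha> \<beta>] f K2(1) K(3) _ _ q]
      ring_convolution_closed(2)[OF R.is_cring \<alpha> \<beta>] by (simp add: ST_def S_def T_def U_def)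
  also have "\<dots> = (\<Oplus>\<^bsub>M\<^esub>p\<in>factor_pairs H ST U q. finsum M g {t \<in> Tr. (\<lambda>(a, b, c). (a \<otimes> b, c)) t = p})"
    by (rule M.finsum_cong') (use left g in \<open>auto intro!: M.finsum_closed\<close>)
  also have "\<dots> = finsum M g Tr"
    by (rule M.add.finprod_fibres[OF fin finite_factor_pairs[OF K2(1) K(3) q] _ g])
      (force simp: Tr_def factor_pairs_def ST_def)
  also have "\<dots> = (\<Oplus>\<^bsub>M\<^esub>p\<in>factor_pairs H S TU q. finsum M g {t \<in> Tr. (\<lambda>(a, b, c). (a, b \<otimes> c)) t = p})"
    by (rule M.add.finprod_fibres[OF fin finite_factor_pairs[OF K(1) K2(2) q] _ g, symmetric])
      (force simp: Tr_def factor_pairs_def TU_def assoc)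
  also have "\<dots> = finsum M (\<lambda>(a, v). \<alpha> a \<odot>\<^bsub>M\<^esub> convolution H M (smult M) \<beta> f v) (factor_pairs H S TU q)"
    by (rule M.finsum_cong'[symmetric]) (use right g in \<open>auto intro!: M.finsum_closed\<close>)
  also have "\<dots> = convolution H M (smult M) \<alpha> (convolution H M (smult M) \<beta> f) q"
    using convolution_eq[OF assms(1) \<alpha> convolution_closed(1)[OF assms(1) \<beta> f] K(1) K2(2) _ _ q]
      convolution_closed(2)[OF assms(1) \<beta> f] by (simp add: TU_def S_def T_def U_def)
  finally show "convolution H M (smult M) (convolution H R (monoid.mult R) \<alpha> \<beta>) f q =
      convolution H M (smult M) \<alpha> (convolution H M (smult M) \<beta> f) q" .
qed

lemma one_fun_carrier:
  assumes "cring R"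
  shows "(\<lambda>q\<in>carrier H. if q = \<one> then \<one>\<^bsub>R\<^esub> else \<zero>\<^bsub>R\<^esub>) \<in> fun_carrier R"
proof -
  interpret cring R by fact
  show ?thesis by (rule fun_carrierI[OF _ _ one_mem]) (auto simp: support_def)
qed

lemma convolution_one:
  assumes "module R M" and f: "f \<in> fun_carrier M"
  shows "convolution H M (smult M) (\<lambda>q\<in>carrier H. if q = \<one> then \<one>\<^bsub>R\<^esub> else \<zero>\<^bsub>R\<^esub>) f = f"
proof (rule extensionalityI[OF convolution_extensional fun_carrierD(2)[OF f]])
  interpret module R M by fact
  let ?e = "\<lambda>q\<in>carrier H. if q = \<one> then \<one>\<^bsub>R\<^esub> else \<zero>\<^bsub>R\<^esub>"
  fix q assume q: "q \<in> carrier H"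
  have "convolution H M (smult M) ?e f q = finsum M (\<lambda>(a, b). ?e a \<odot>\<^bsub>M\<^esub> f b) {(\<one>, q)}"
    by (rule convolution_eq_finsum[OF assms(1) _ fun_carrierD(1)[OF f] q])
      (use q in \<open>auto simp: factor_pairs_def support_def split: if_splits\<close>)
  then show "convolution H M (smult M) ?e f q = f q"
    using q fun_carrierD(4)[OF f q] by simp
qed

lemma ring_convolution_comm:
  assumes "cring R" and \<alpha>: "\<alpha> \<in> fun_carrier R" and \<beta>: "\<beta> \<in> fun_carrier R"
  shows "convolution H R (monoid.mult R) \<alpha> \<beta> = convolution H R (monoid.mult R) \<beta> \<alpha>"
proof (rule extensionalityI[OF convolution_extensional convolution_extensional])
  interpret R: cring R by fact
  let ?S = "support H R \<alpha>" and ?T = "support H R \<beta>"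
  note K = fun_carrierD(3)[OF \<alpha>] fun_carrierD(3)[OF \<beta>]
  note sub = K[THEN subset_carrier, THEN subsetD]
  fix q assume q: "q \<in> carrier H"
  have swap: "factor_pairs H ?S ?T q = prod.swap ` factor_pairs H ?T ?S q"
    using sub by (force simp: factor_pairs_def m_comm)
  note closed = fun_carrierD(4)[OF \<alpha>] fun_carrierD(4)[OF \<beta>]
  have "convolution H R (monoid.mult R) \<alpha> \<beta> q =
      finsum R (\<lambda>(a, b). \<alpha> a \<otimes>\<^bsub>R\<^esub> \<beta> b) (prod.swap ` factor_pairs H ?T ?S q)"
    using ring_convolution_eq[OF assms K subset_refl subset_refl q] swap by simp
  also have "\<dots> = (\<Oplus>\<^bsub>R\<^esub>p\<in>factor_pairs H ?T ?S q. (\<lambda>(a, b). \<alpha> a \<otimes>\<^bsub>R\<^esub> \<beta> b) (prod.swap p))"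
    by (rule R.finsum_reindex) (auto simp: factor_pairs_def support_def closed)
  also have "\<dots> = finsum R (\<lambda>(b, a). \<beta> b \<otimes>\<^bsub>R\<^esub> \<alpha> a) (factor_pairs H ?T ?S q)"
    by (rule R.finsum_cong') (auto simp: factor_pairs_def support_def closed intro: R.m_comm)
  also have "\<dots> = convolution H R (monoid.mult R) \<beta> \<alpha> q"
    using ring_convolution_eq[OF assms(1) \<beta> \<alpha> K(2,1) subset_refl subset_refl q] by simp
  finally show "convolution H R (monoid.mult R) \<alpha> \<beta> q = convolution H R (monoid.mult R) \<beta> \<alpha> q" .
qed

theorem cring_fun_ring:
  assumes "cring R"
  shows "cring (fun_ring H R (fun_carrier R))" (is "cring ?F")
proof -
  interpret R: cring R by fact
  note reg = R.module_regular_module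
  note assoc = convolution_assoc[OF reg, simplified]
    and unit = convolution_one[OF reg, simplified]
    and distr = convolution_add_left[OF reg, simplified]
  show ?thesis
  proof (rule cringI)
    show "abelian_group ?F"
      by (rule abelian_group_fun_carrier[OF R.is_abelian_group]) (auto simp: fun_ring_def)
    show "comm_monoid ?F"
      by (rule comm_monoidI)
        (auto simp: fun_ring_def one_fun_carrier ring_convolution_closed(1) assms assoc unit
          intro: ring_convolution_comm[OF assms])
    show "\<And>x y z. x \<in> carrier ?F \<Longrightarrow> y \<in> carrier ?F \<Longrightarrow> z \<in> carrier ?F \<Longrightarrow>
        (x \<oplus>\<^bsub>?F\<^esub> y) \<otimes>\<^bsub>?F\<^esub> z = x \<otimes>\<^bsub>?F\<^esub> z \<oplus>\<^bsub>?F\<^esub> y \<otimes>\<^bsub>?F\<^esub> z"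
      by (simp add: fun_ring_def distr)
  qed
qed

theorem module_fun_module:
  assumes "module R M"
  shows "module (fun_ring H R (fun_carrier R)) (fun_module H M (fun_carrier M))"
proof -
  interpret module R M by fact
  show ?thesis
  proof (rule moduleI)
    show "cring (fun_ring H R (fun_carrier R))" by (rule cring_fun_ring) (rule R.is_cring)
    show "abelian_group (fun_module H M (fun_carrier M))"
      by (rule abelian_group_fun_carrier[OF M.abelian_group_axioms]) (auto simp: fun_module_def)
  qed (use assms in \<open>simp_all add: fun_ring_def fun_module_def convolution_closed(1)
      convolution_add_left convolution_add_right convolution_assoc convolution_one\<close>)
qed

end

section \<open>Restriction of scalars\<close>

lemma module_restrict_scalars:
  assumes "cring R" and "module S N" and \<phi>: "\<phi> \<in> ring_hom R S"
  shows "module R (restrict_scalars \<phi> N)"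
proof -
  interpret R: cring R by fact
  interpret N: module S N by fact
  show ?thesis
  proof (rule moduleI)
    show "abelian_group (restrict_scalars \<phi> N)"
      by (rule abelian_groupI)
        (auto simp: restrict_scalars_def N.M.a_assoc intro: N.M.a_comm N.M.l_neg)
  qed (use \<phi> in \<open>auto simp: restrict_scalars_def ring_hom_closed ring_hom_add ring_hom_mult
      ring_hom_one N.smult_l_distr N.smult_r_distr N.smult_assoc1 R.is_cring\<close>)
qed

section \<open>Functions on a monoid and on its group of fractions\<close>

text \<open>Commutative cancellative monoids of finite type.\<close>

locale finite_type_comm_monoid_cancel = comm_monoid_cancel \<Gamma> for \<Gamma> (structure) +
  assumes finite_type: "finite_type_monoid \<Gamma>"
begin

lemmas frac_eq_iff = groth_frac_eq_iff[OF comm_monoid_cancel_axioms]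
lemmas frac_mult = groth_frac_mult[OF comm_monoid_cancel_axioms]

lemma frac_closed [simp]:
  "m \<in> carrier \<Gamma> \<Longrightarrow> n \<in> carrier \<Gamma> \<Longrightarrow> groth_frac \<Gamma> m n \<in> carrier (groth \<Gamma>)"
  by (auto simp: groth_def groth_frac_def intro: quotientI)

lemma groth_cases:
  assumes "q \<in> carrier (groth \<Gamma>)"
  obtains m n where "m \<in> carrier \<Gamma>" "n \<in> carrier \<Gamma>" "q = groth_frac \<Gamma> m n"
  using assms by (auto simp: groth_def groth_frac_def elim!: quotientE)

lemma groth_one: "\<one>\<^bsub>groth \<Gamma>\<^esub> = groth_frac \<Gamma> \<one> \<one>"
  by (simp add: groth_def)

lemma comm_group_groth: "comm_group (groth \<Gamma>)"
proof (rule comm_groupI)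
  fix x y z assume "x \<in> carrier (groth \<Gamma>)" "y \<in> carrier (groth \<Gamma>)" "z \<in> carrier (groth \<Gamma>)"
  then show "x \<otimes>\<^bsub>groth \<Gamma>\<^esub> y \<otimes>\<^bsub>groth \<Gamma>\<^esub> z = x \<otimes>\<^bsub>groth \<Gamma>\<^esub> (y \<otimes>\<^bsub>groth \<Gamma>\<^esub> z)"
    by (elim groth_cases) (simp add: frac_mult m_assoc)
next
  fix x y assume "x \<in> carrier (groth \<Gamma>)" "y \<in> carrier (groth \<Gamma>)"
  then show "x \<otimes>\<^bsub>groth \<Gamma>\<^esub> y \<in> carrier (groth \<Gamma>)"
    and "x \<otimes>\<^bsub>groth \<Gamma>\<^esub> y = y \<otimes>\<^bsub>groth \<Gamma>\<^esub> x"
    by (elim groth_cases; simp add: frac_mult m_comm)+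
next
  show "\<one>\<^bsub>groth \<Gamma>\<^esub> \<in> carrier (groth \<Gamma>)" by (simp add: groth_one)
next
  fix x assume "x \<in> carrier (groth \<Gamma>)"
  then obtain m n where x: "m \<in> carrier \<Gamma>" "n \<in> carrier \<Gamma>" "x = groth_frac \<Gamma> m n"
    by (rule groth_cases)
  then show "\<one>\<^bsub>groth \<Gamma>\<^esub> \<otimes>\<^bsub>groth \<Gamma>\<^esub> x = x" by (simp add: groth_one frac_mult)
  have "groth_frac \<Gamma> n m \<otimes>\<^bsub>groth \<Gamma>\<^esub> x = \<one>\<^bsub>groth \<Gamma>\<^esub>"
    using x by (simp add: groth_one frac_mult frac_eq_iff m_comm)
  then show "\<exists>y\<in>carrier (groth \<Gamma>). y \<otimes>\<^bsub>groth \<Gamma>\<^esub> x = \<one>\<^bsub>groth \<Gamma>\<^esub>"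
    using x by (metis frac_closed)
qed

sublocale G: comm_group "groth \<Gamma>"
  by (rule comm_group_groth)

lemma embed_closed [simp]: "n \<in> carrier \<Gamma> \<Longrightarrow> groth_embed \<Gamma> n \<in> carrier (groth \<Gamma>)"
  by (simp add: groth_embed_def)

lemma embed_mult:
  "m \<in> carrier \<Gamma> \<Longrightarrow> n \<in> carrier \<Gamma> \<Longrightarrow>
    groth_embed \<Gamma> m \<otimes>\<^bsub>groth \<Gamma>\<^esub> groth_embed \<Gamma> n = groth_embed \<Gamma> (m \<otimes> n)"
  by (simp add: groth_embed_def frac_mult)

lemma embed_one: "groth_embed \<Gamma> \<one> = \<one>\<^bsub>groth \<Gamma>\<^esub>"
  by (simp add: groth_embed_def groth_one)

lemma embed_eq_iff [simp]:
  "m \<in> carrier \<Gamma> \<Longrightarrow> n \<in> carrier \<Gamma> \<Longrightarrow> groth_embed \<Gamma> m = groth_embed \<Gamma> n \<longleftrightarrow> m = n"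
  by (simp add: groth_embed_def frac_eq_iff)

lemma inj_on_embed: "inj_on (groth_embed \<Gamma>) (carrier \<Gamma>)"
  by (simp add: inj_on_def)

lemma image_embed_mult:
  assumes "x \<in> groth_embed \<Gamma> ` carrier \<Gamma>" "y \<in> groth_embed \<Gamma> ` carrier \<Gamma>"
  shows "x \<otimes>\<^bsub>groth \<Gamma>\<^esub> y \<in> groth_embed \<Gamma> ` carrier \<Gamma>"
  using assms by (auto simp: embed_mult)

lemma finite_factor_pairs_monoid:
  assumes "n \<in> carrier \<Gamma>"
  shows "finite (factor_pairs \<Gamma> (carrier \<Gamma>) (carrier \<Gamma>) n)"
  using finite_type assms by (simp add: finite_type_monoid_def factor_pairs_def eq_commute)

sublocale F: support_family \<Gamma> "Pow (carrier \<Gamma>)"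
proof
  fix S T q assume "S \<in> Pow (carrier \<Gamma>)" "T \<in> Pow (carrier \<Gamma>)" "q \<in> carrier \<Gamma>"
  then show "finite (factor_pairs \<Gamma> S T q)"
    by (intro finite_subset[OF _ finite_factor_pairs_monoid[of q]]) (auto simp: factor_pairs_def)
qed auto

text \<open>The sets of fractions admitting a common denominator.\<close>

definition common_denom_sets :: "('a \<times> 'a) set set set" where
  "common_denom_sets = {S. S \<subseteq> carrier (groth \<Gamma>) \<and>
     (\<exists>d\<in>carrier \<Gamma>. \<forall>q\<in>S. groth_embed \<Gamma> d \<otimes>\<^bsub>groth \<Gamma>\<^esub> q \<in> groth_embed \<Gamma> ` carrier \<Gamma>)}"

lemma common_denom_setsI:
  assumes "S \<subseteq> carrier (groth \<Gamma>)" "d \<in> carrier \<Gamma>"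
    and "\<And>q. q \<in> S \<Longrightarrow> groth_embed \<Gamma> d \<otimes>\<^bsub>groth \<Gamma>\<^esub> q \<in> groth_embed \<Gamma> ` carrier \<Gamma>"
  shows "S \<in> common_denom_sets"
  using assms by (auto simp: common_denom_sets_def)

lemma common_denom_setsE:
  assumes "S \<in> common_denom_sets"
  obtains d where "S \<subseteq> carrier (groth \<Gamma>)" "d \<in> carrier \<Gamma>"
    "\<And>q. q \<in> S \<Longrightarrow> groth_embed \<Gamma> d \<otimes>\<^bsub>groth \<Gamma>\<^esub> q \<in> groth_embed \<Gamma> ` carrier \<Gamma>"
  using assms by (auto simp: common_denom_sets_def)

text \<open>Multiplication by the two denominators carries the factorisations of \<open>q\<close> injectively to
  factorisations of a single element of \<open>\<Gamma>\<close>, of which there are finitely many.\<close>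

lemma finite_factor_pairs_common_denom:
  assumes S: "S \<in> common_denom_sets" and T: "T \<in> common_denom_sets"
    and q: "q \<in> carrier (groth \<Gamma>)"
  shows "finite (factor_pairs (groth \<Gamma>) S T q)"
proof -
  obtain d where d: "S \<subseteq> carrier (groth \<Gamma>)" "d \<in> carrier \<Gamma>"
    "\<And>q. q \<in> S \<Longrightarrow> groth_embed \<Gamma> d \<otimes>\<^bsub>groth \<Gamma>\<^esub> q \<in> groth_embed \<Gamma> ` carrier \<Gamma>"
    using common_denom_setsE[OF S] by blast
  obtain e where e: "T \<subseteq> carrier (groth \<Gamma>)" "e \<in> carrier \<Gamma>"
    "\<And>q. q \<in> T \<Longrightarrow> groth_embed \<Gamma> e \<otimes>\<^bsub>groth \<Gamma>\<^esub> q \<in> groth_embed \<Gamma> ` carrier \<Gamma>"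
    using common_denom_setsE[OF T] by blast
  let ?q = "groth_embed \<Gamma> (d \<otimes> e) \<otimes>\<^bsub>groth \<Gamma>\<^esub> q"
  define h where "h = (\<lambda>(a, b). (groth_embed \<Gamma> d \<otimes>\<^bsub>groth \<Gamma>\<^esub> a, groth_embed \<Gamma> e \<otimes>\<^bsub>groth \<Gamma>\<^esub> b))"
  have inj: "inj_on h (factor_pairs (groth \<Gamma>) S T q)"
    using d(1,2) e(1,2) by (auto simp: inj_on_def h_def factor_pairs_def subset_iff)
  have mult_h: "\<exists>x y. x \<in> carrier \<Gamma> \<and> y \<in> carrier \<Gamma> \<and> h (a, b) = (groth_embed \<Gamma> x, groth_embed \<Gamma> y) \<and>
      groth_embed \<Gamma> (x \<otimes> y) = ?q"
    if "(a, b) \<in> factor_pairs (groth \<Gamma>) S T q" for a b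
  proof -
    have ab: "a \<in> S" "b \<in> T" "a \<otimes>\<^bsub>groth \<Gamma>\<^esub> b = q" using that by (auto simp: factor_pairs_def)
    obtain x where x: "x \<in> carrier \<Gamma>" "groth_embed \<Gamma> d \<otimes>\<^bsub>groth \<Gamma>\<^esub> a = groth_embed \<Gamma> x"
      using d(3)[OF ab(1)] by blast
    obtain y where y: "y \<in> carrier \<Gamma>" "groth_embed \<Gamma> e \<otimes>\<^bsub>groth \<Gamma>\<^esub> b = groth_embed \<Gamma> y"
      using e(3)[OF ab(2)] by blast
    have "a \<in> carrier (groth \<Gamma>)" "b \<in> carrier (groth \<Gamma>)" using ab d(1) e(1) by auto
    then have "?q = (groth_embed \<Gamma> d \<otimes>\<^bsub>groth \<Gamma>\<^esub> a) \<otimes>\<^bsub>groth \<Gamma>\<^esub> (groth_embed \<Gamma> e \<otimes>\<^bsub>groth \<Gamma>\<^esub> b)"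
      using d(2) e(2) by (simp add: embed_mult[symmetric] ab(3)[symmetric] G.m_ac)
    then have "?q = groth_embed \<Gamma> (x \<otimes> y)" using x y by (simp add: embed_mult)
    then show ?thesis using x y by (auto simp: h_def)
  qed
  show ?thesis
  proof (cases "\<exists>n\<in>carrier \<Gamma>. ?q = groth_embed \<Gamma> n")
    case True
    then obtain n where n: "n \<in> carrier \<Gamma>" "?q = groth_embed \<Gamma> n" by blast
    have "h ` factor_pairs (groth \<Gamma>) S T q \<subseteq>
        map_prod (groth_embed \<Gamma>) (groth_embed \<Gamma>) ` factor_pairs \<Gamma> (carrier \<Gamma>) (carrier \<Gamma>) n"
    proof (rule image_subsetI, clarify)
      fix a b assume "(a, b) \<in> factor_pairs (groth \<Gamma>) S T q"
      then obtain x y where xy: "x \<in> carrier \<Gamma>" "y \<in> carrier \<Gamma>"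
          "h (a, b) = (groth_embed \<Gamma> x, groth_embed \<Gamma> y)" "groth_embed \<Gamma> (x \<otimes> y) = groth_embed \<Gamma> n"
        using mult_h n(2) by metis
      then have "(x, y) \<in> factor_pairs \<Gamma> (carrier \<Gamma>) (carrier \<Gamma>) n"
        using n(1) by (simp add: factor_pairs_def)
      then show "h (a, b) \<in>
          map_prod (groth_embed \<Gamma>) (groth_embed \<Gamma>) ` factor_pairs \<Gamma> (carrier \<Gamma>) (carrier \<Gamma>) n"
        using xy(3) by (simp add: rev_image_eqI)
    qed
    then have "finite (h ` factor_pairs (groth \<Gamma>) S T q)"
      using finite_factor_pairs_monoid[OF n(1)] by (meson finite_imageI finite_subset)
    then show ?thesis using inj by (rule finite_imageD)
  next
    case False
    then have "factor_pairs (groth \<Gamma>) S T q = {}"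
      using mult_h by (metis m_closed surj_pair equals0I)
    then show ?thesis by simp
  qed
qed

sublocale Ff: support_family "groth \<Gamma>" common_denom_sets
proof
  fix S T assume S: "S \<in> common_denom_sets" and T: "T \<in> common_denom_sets"
  obtain d where d: "S \<subseteq> carrier (groth \<Gamma>)" "d \<in> carrier \<Gamma>"
    "\<And>q. q \<in> S \<Longrightarrow> groth_embed \<Gamma> d \<otimes>\<^bsub>groth \<Gamma>\<^esub> q \<in> groth_embed \<Gamma> ` carrier \<Gamma>"
    using common_denom_setsE[OF S] by blast
  obtain e where e: "T \<subseteq> carrier (groth \<Gamma>)" "e \<in> carrier \<Gamma>"
    "\<And>q. q \<in> T \<Longrightarrow> groth_embed \<Gamma> e \<otimes>\<^bsub>groth \<Gamma>\<^esub> q \<in> groth_embed \<Gamma> ` carrier \<Gamma>"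
    using common_denom_setsE[OF T] by blast
  show "S \<union> T \<in> common_denom_sets"
  proof (rule common_denom_setsI)
    show "S \<union> T \<subseteq> carrier (groth \<Gamma>)" "d \<otimes> e \<in> carrier \<Gamma>" using d e by auto
    fix q assume "q \<in> S \<union> T"
    then show "groth_embed \<Gamma> (d \<otimes> e) \<otimes>\<^bsub>groth \<Gamma>\<^esub> q \<in> groth_embed \<Gamma> ` carrier \<Gamma>"
    proof
      assume q: "q \<in> S"
      then have "groth_embed \<Gamma> (d \<otimes> e) \<otimes>\<^bsub>groth \<Gamma>\<^esub> q =
          groth_embed \<Gamma> e \<otimes>\<^bsub>groth \<Gamma>\<^esub> (groth_embed \<Gamma> d \<otimes>\<^bsub>groth \<Gamma>\<^esub> q)"
        using d(1,2) e(2) by (auto simp: embed_mult[symmetric] G.m_ac subset_iff)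
      then show ?thesis using image_embed_mult[OF _ d(3)[OF q]] e(2) by simp
    next
      assume q: "q \<in> T"
      then have "groth_embed \<Gamma> (d \<otimes> e) \<otimes>\<^bsub>groth \<Gamma>\<^esub> q =
          groth_embed \<Gamma> d \<otimes>\<^bsub>groth \<Gamma>\<^esub> (groth_embed \<Gamma> e \<otimes>\<^bsub>groth \<Gamma>\<^esub> q)"
        using e(1,2) d(2) by (auto simp: embed_mult[symmetric] G.m_ac subset_iff)
      then show ?thesis using image_embed_mult[OF _ e(3)[OF q]] d(2) by simp
    qed
  qed
  show "(\<lambda>(a, b). a \<otimes>\<^bsub>groth \<Gamma>\<^esub> b) ` (S \<times> T) \<in> common_denom_sets"
  proof (rule common_denom_setsI)
    show "(\<lambda>(a, b). a \<otimes>\<^bsub>groth \<Gamma>\<^esub> b) ` (S \<times> T) \<subseteq> carrier (groth \<Gamma>)" "d \<otimes> e \<in> carrier \<Gamma>"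
      using d e by (auto simp: subset_iff)
    fix q assume "q \<in> (\<lambda>(a, b). a \<otimes>\<^bsub>groth \<Gamma>\<^esub> b) ` (S \<times> T)"
    then obtain a b where ab: "a \<in> S" "b \<in> T" "q = a \<otimes>\<^bsub>groth \<Gamma>\<^esub> b" by auto
    then have "a \<in> carrier (groth \<Gamma>)" "b \<in> carrier (groth \<Gamma>)" using d(1) e(1) by auto
    then have "groth_embed \<Gamma> (d \<otimes> e) \<otimes>\<^bsub>groth \<Gamma>\<^esub> q =
        (groth_embed \<Gamma> d \<otimes>\<^bsub>groth \<Gamma>\<^esub> a) \<otimes>\<^bsub>groth \<Gamma>\<^esub> (groth_embed \<Gamma> e \<otimes>\<^bsub>groth \<Gamma>\<^esub> b)"
      using d(2) e(2) by (simp add: embed_mult[symmetric] ab(3) G.m_ac)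
    then show "groth_embed \<Gamma> (d \<otimes> e) \<otimes>\<^bsub>groth \<Gamma>\<^esub> q \<in> groth_embed \<Gamma> ` carrier \<Gamma>"
      using image_embed_mult[OF d(3)[OF ab(1)] e(3)[OF ab(2)]] by simp
  qed
next
  show "{\<one>\<^bsub>groth \<Gamma>\<^esub>} \<in> common_denom_sets"
    by (rule common_denom_setsI[OF _ one_closed]) auto
next
  fix S T assume "S \<in> common_denom_sets" "T \<subseteq> S"
  then show "T \<in> common_denom_sets" unfolding common_denom_sets_def by blast
qed (auto simp: finite_factor_pairs_common_denom elim: common_denom_setsE)

lemma F_fun_carrier: "F.fun_carrier A = carrier \<Gamma> \<rightarrow>\<^sub>E carrier A"
  by (auto simp: F.fun_carrier_def support_def)

lemma Ff_fun_carrier: "Ff.fun_carrier A = Ff_carrier \<Gamma> A"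
  unfolding Ff.fun_carrier_def Ff_carrier_def
  by (auto simp: support_def common_denom_sets_def)

lemma cring_F_ring: "cring R \<Longrightarrow> cring (F_ring \<Gamma> R)"
  using F.cring_fun_ring by (simp add: F_fun_carrier F_ring_def)

lemma module_F_module: "module R M \<Longrightarrow> module (F_ring \<Gamma> R) (F_module \<Gamma> M)"
  using F.module_fun_module by (simp add: F_fun_carrier F_ring_def F_module_def)

lemma module_Ff_module: "module R M \<Longrightarrow> module (Ff_ring \<Gamma> R) (Ff_module \<Gamma> M)"
  using Ff.module_fun_module by (simp add: Ff_fun_carrier Ff_ring_def Ff_module_def)

section \<open>Extension by zero\<close>

lemma ext_zero_embed [simp]: "n \<in> carrier \<Gamma> \<Longrightarrow> ext_zero \<Gamma> A f (groth_embed \<Gamma> n) = f n"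
  by (simp add: ext_zero_def inv_into_f_f[OF inj_on_embed])

lemma ext_zero_outside:
  "q \<in> carrier (groth \<Gamma>) \<Longrightarrow> q \<notin> groth_embed \<Gamma> ` carrier \<Gamma> \<Longrightarrow> ext_zero \<Gamma> A f q = \<zero>\<^bsub>A\<^esub>"
  by (simp add: ext_zero_def)

lemma ext_zero_eqI:
  assumes "g \<in> extensional (carrier (groth \<Gamma>))"
    and "\<And>n. n \<in> carrier \<Gamma> \<Longrightarrow> g (groth_embed \<Gamma> n) = f n"
    and "\<And>q. q \<in> carrier (groth \<Gamma>) \<Longrightarrow> q \<notin> groth_embed \<Gamma> ` carrier \<Gamma> \<Longrightarrow> g q = \<zero>\<^bsub>A\<^esub>"
  shows "ext_zero \<Gamma> A f = g"
proof (rule extensionalityI)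
  show "ext_zero \<Gamma> A f \<in> extensional (carrier (groth \<Gamma>))" by (simp add: ext_zero_def)
  show "ext_zero \<Gamma> A f q = g q" if "q \<in> carrier (groth \<Gamma>)" for q
    using that assms by (cases "q \<in> groth_embed \<Gamma> ` carrier \<Gamma>") (auto simp: ext_zero_outside)
qed (rule assms)

lemma support_ext_zero: "support (groth \<Gamma>) A (ext_zero \<Gamma> A f) \<subseteq> groth_embed \<Gamma> ` carrier \<Gamma>"
  using ext_zero_outside by (fastforce simp: support_def)

lemma ext_zero_closed:
  assumes "abelian_group A" "f \<in> carrier \<Gamma> \<rightarrow>\<^sub>E carrier A"
  shows "ext_zero \<Gamma> A f \<in> Ff_carrier \<Gamma> A"
proof -
  interpret A: abelian_group A by fact
  have "groth_embed \<Gamma> ` carrier \<Gamma> \<in> common_denom_sets"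
    by (rule common_denom_setsI[OF _ one_closed]) (auto simp: embed_mult)
  then show ?thesis
    unfolding Ff_fun_carrier[symmetric]
  proof (intro Ff.fun_carrierI[OF _ _ _ support_ext_zero])
    show "ext_zero \<Gamma> A f q \<in> carrier A" if "q \<in> carrier (groth \<Gamma>)" for q
      using that assms(2) by (cases "q \<in> groth_embed \<Gamma> ` carrier \<Gamma>") (auto simp: ext_zero_outside)
  qed (simp add: ext_zero_def)
qed

lemma ext_zero_add:
  assumes "abelian_group A"
  shows "ext_zero \<Gamma> A (\<lambda>n\<in>carrier \<Gamma>. f n \<oplus>\<^bsub>A\<^esub> g n) =
    (\<lambda>q\<in>carrier (groth \<Gamma>). ext_zero \<Gamma> A f q \<oplus>\<^bsub>A\<^esub> ext_zero \<Gamma> A g q)"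
proof -
  interpret A: abelian_group A by fact
  show ?thesis by (rule ext_zero_eqI) (auto simp: ext_zero_outside)
qed

lemma ext_zero_convolution:
  assumes "module R M" and \<alpha>: "\<alpha> \<in> carrier \<Gamma> \<rightarrow>\<^sub>E carrier R" and f: "f \<in> carrier \<Gamma> \<rightarrow>\<^sub>E carrier M"
  shows "ext_zero \<Gamma> M (convolution \<Gamma> M (smult M) \<alpha> f) =
    convolution (groth \<Gamma>) M (smult M) (ext_zero \<Gamma> R \<alpha>) (ext_zero \<Gamma> M f)"
proof (rule ext_zero_eqI[OF Ff.convolution_extensional])
  interpret module R M by fact
  let ?\<alpha> = "ext_zero \<Gamma> R \<alpha>" and ?f = "ext_zero \<Gamma> M f"
  have "?\<alpha> \<in> Ff.fun_carrier R" "?f \<in> Ff.fun_carrier M"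
    using ext_zero_closed[OF R.is_abelian_group \<alpha>] ext_zero_closed[OF M.abelian_group_axioms f]
    by (simp_all add: Ff_fun_carrier)
  note ext_funcset = this[THEN Ff.fun_carrierD(1)]
  have closed: "\<alpha> a \<in> carrier R" "f a \<in> carrier M" if "a \<in> carrier \<Gamma>" for a
    using that \<alpha> f by auto
  have supp: "x \<in> groth_embed \<Gamma> ` carrier \<Gamma> \<and> y \<in> groth_embed \<Gamma> ` carrier \<Gamma> \<and> x \<otimes>\<^bsub>groth \<Gamma>\<^esub> y = q"
    if "(x, y) \<in> factor_pairs (groth \<Gamma>) (support (groth \<Gamma>) R ?\<alpha>) (support (groth \<Gamma>) M ?f) q" for x y q
    using that support_ext_zero[of R \<alpha>] support_ext_zero[of M f] by (auto simp: factor_pairs_def)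
  {
    fix n assume n: "n \<in> carrier \<Gamma>"
    let ?P = "factor_pairs \<Gamma> (carrier \<Gamma>) (carrier \<Gamma>) n"
    let ?h = "map_prod (groth_embed \<Gamma>) (groth_embed \<Gamma>)"
    have sub: "factor_pairs (groth \<Gamma>) (support (groth \<Gamma>) R ?\<alpha>) (support (groth \<Gamma>) M ?f)
        (groth_embed \<Gamma> n) \<subseteq> ?h ` ?P"
    proof clarify
      fix x y assume "(x, y) \<in> factor_pairs (groth \<Gamma>) (support (groth \<Gamma>) R ?\<alpha>)
        (support (groth \<Gamma>) M ?f) (groth_embed \<Gamma> n)"
      from supp[OF this] obtain a b where ab: "a \<in> carrier \<Gamma>" "b \<in> carrier \<Gamma>"
          "x = groth_embed \<Gamma> a" "y = groth_embed \<Gamma> b"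
          "x \<otimes>\<^bsub>groth \<Gamma>\<^esub> y = groth_embed \<Gamma> n"
        by (elim conjE imageE) simp
      then have "(a, b) \<in> ?P" using n by (simp add: factor_pairs_def embed_mult)
      then show "(x, y) \<in> ?h ` ?P" using ab by (simp add: rev_image_eqI)
    qed
    have "convolution (groth \<Gamma>) M (smult M) ?\<alpha> ?f (groth_embed \<Gamma> n) =
        finsum M (\<lambda>(x, y). ?\<alpha> x \<odot>\<^bsub>M\<^esub> ?f y) (?h ` ?P)"
      by (rule convolution_eq_finsum[OF assms(1) ext_funcset _ _ _ sub])
        (use n finite_factor_pairs_monoid in \<open>auto simp: factor_pairs_def[of _ "carrier _"] embed_mult\<close>)
    also have "\<dots> = finsum M (\<lambda>p. (\<lambda>(x, y). ?\<alpha> x \<odot>\<^bsub>M\<^esub> ?f y) (?h p)) ?P"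
      by (rule M.finsum_reindex)
        (auto simp: factor_pairs_def inj_on_def closed)
    also have "\<dots> = finsum M (\<lambda>(a, b). \<alpha> a \<odot>\<^bsub>M\<^esub> f b) ?P"
      by (rule M.finsum_cong') (auto simp: factor_pairs_def closed)
    also have "\<dots> = convolution \<Gamma> M (smult M) \<alpha> f n"
      by (rule convolution_eq_finsum[OF assms(1) _ _ n finite_factor_pairs_monoid[OF n]
            subset_refl, symmetric])
        (auto simp: factor_pairs_def support_def closed)
    finally show "convolution (groth \<Gamma>) M (smult M) ?\<alpha> ?f (groth_embed \<Gamma> n) =
        convolution \<Gamma> M (smult M) \<alpha> f n" .
  next
    fix q assume q: "q \<in> carrier (groth \<Gamma>)" "q \<notin> groth_embed \<Gamma> ` carrier \<Gamma>"
    have "factor_pairs (groth \<Gamma>) (support (groth \<Gamma>) R ?\<alpha>) (support (groth \<Gamma>) M ?f) q \<subseteq> {}"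
      by (rule subrelI) (use supp image_embed_mult q(2) in metis)
    then have "convolution (groth \<Gamma>) M (smult M) ?\<alpha> ?f q =
        finsum M (\<lambda>(x, y). ?\<alpha> x \<odot>\<^bsub>M\<^esub> ?f y) {}"
      by (intro convolution_eq_finsum[OF assms(1) ext_funcset q(1)]) auto
    then show "convolution (groth \<Gamma>) M (smult M) ?\<alpha> ?f q = \<zero>\<^bsub>M\<^esub>" by simp
  }
qed

lemma ext_zero_ring_hom:
  assumes "cring R"
  shows "ext_zero \<Gamma> R \<in> ring_hom (F_ring \<Gamma> R) (Ff_ring \<Gamma> R)"
proof (rule ring_hom_memI)
  interpret R: cring R by fact
  note reg = R.module_regular_module
  have [simp]: "ext_zero \<Gamma> (regular_module R) = ext_zero \<Gamma> R"
    by (simp add: ext_zero_def fun_eq_iff)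
  fix x y assume "x \<in> carrier (F_ring \<Gamma> R)" "y \<in> carrier (F_ring \<Gamma> R)"
  then have xy: "x \<in> carrier \<Gamma> \<rightarrow>\<^sub>E carrier R" "y \<in> carrier \<Gamma> \<rightarrow>\<^sub>E carrier R"
    by (simp_all add: F_ring_def fun_ring_def)
  show "ext_zero \<Gamma> R x \<in> carrier (Ff_ring \<Gamma> R)"
    using ext_zero_closed[OF R.is_abelian_group xy(1)] by (simp add: Ff_ring_def fun_ring_def)
  show "ext_zero \<Gamma> R (x \<otimes>\<^bsub>F_ring \<Gamma> R\<^esub> y) = ext_zero \<Gamma> R x \<otimes>\<^bsub>Ff_ring \<Gamma> R\<^esub> ext_zero \<Gamma> R y"
    using ext_zero_convolution[OF reg, of x y] xy
    by (simp add: F_ring_def Ff_ring_def fun_ring_def)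
  show "ext_zero \<Gamma> R (x \<oplus>\<^bsub>F_ring \<Gamma> R\<^esub> y) = ext_zero \<Gamma> R x \<oplus>\<^bsub>Ff_ring \<Gamma> R\<^esub> ext_zero \<Gamma> R y"
    using ext_zero_add[OF R.is_abelian_group] by (simp add: F_ring_def Ff_ring_def fun_ring_def)
next
  interpret R: cring R by fact
  have "\<one>\<^bsub>groth \<Gamma>\<^esub> \<in> groth_embed \<Gamma> ` carrier \<Gamma>" by (simp add: embed_one[symmetric])
  moreover have "groth_embed \<Gamma> n = \<one>\<^bsub>groth \<Gamma>\<^esub> \<longleftrightarrow> n = \<one>" if "n \<in> carrier \<Gamma>" for n
    using that by (simp add: embed_one[symmetric])
  ultimately show "ext_zero \<Gamma> R \<one>\<^bsub>F_ring \<Gamma> R\<^esub> = \<one>\<^bsub>Ff_ring \<Gamma> R\<^esub>"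
    by (intro ext_zero_eqI) (auto simp: F_ring_def Ff_ring_def fun_ring_def)
qed

lemma ext_zero_inj_on: "inj_on (ext_zero \<Gamma> A) (carrier \<Gamma> \<rightarrow>\<^sub>E carrier A)"
proof (rule inj_onI)
  fix f g assume fg: "f \<in> carrier \<Gamma> \<rightarrow>\<^sub>E carrier A" "g \<in> carrier \<Gamma> \<rightarrow>\<^sub>E carrier A"
    and eq: "ext_zero \<Gamma> A f = ext_zero \<Gamma> A g"
  show "f = g"
  proof (rule PiE_ext[OF fg])
    show "f n = g n" if "n \<in> carrier \<Gamma>" for n
      using fun_cong[OF eq, of "groth_embed \<Gamma> n"] that by simp
  qed
qed

lemma ext_zero_module_morphism:
  assumes "module R M"
  shows "module_morphism (F_ring \<Gamma> R) (F_module \<Gamma> M)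
    (restrict_scalars (ext_zero \<Gamma> R) (Ff_module \<Gamma> M)) (ext_zero \<Gamma> M)"
proof -
  interpret module R M by fact
  have "module (F_ring \<Gamma> R) (restrict_scalars (ext_zero \<Gamma> R) (Ff_module \<Gamma> M))"
    by (rule module_restrict_scalars[OF cring_F_ring module_Ff_module ext_zero_ring_hom])
      (use assms R.is_cring in auto)
  then show ?thesis
    using module_F_module[OF assms] ext_zero_closed[OF M.abelian_group_axioms]
      ext_zero_add[OF M.abelian_group_axioms] ext_zero_convolution[OF assms]
    by (auto simp: module_morphism_def restrict_scalars_def F_module_def Ff_module_def F_ring_def
        fun_ring_def fun_module_def)
qed

end

theorem proposition3p3:
  fixes R :: "('r, 'k) ring_scheme"
    and M :: "('r, 'm, 'l) module_scheme"
    and \<Gamma> :: "('g, 'e) monoid_scheme"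
  assumes "cring R"
    and "module R M"
    and "comm_monoid_cancel \<Gamma>"
    and "finite_type_monoid \<Gamma>"
  shows "module (Ff_ring \<Gamma> R) (Ff_module \<Gamma> M) \<and>
    module_morphism (F_ring \<Gamma> R) (F_module \<Gamma> M)
      (restrict_scalars (ext_zero \<Gamma> R) (Ff_module \<Gamma> M)) (ext_zero \<Gamma> M) \<and>
    inj_on (ext_zero \<Gamma> M) (carrier (F_module \<Gamma> M))"
proof -
  interpret finite_type_comm_monoid_cancel \<Gamma>
    using assms(3,4) by (simp add: finite_type_comm_monoid_cancel_def
        finite_type_comm_monoid_cancel_axioms_def)
  have "carrier (F_module \<Gamma> M) = carrier \<Gamma> \<rightarrow>\<^sub>E carrier M"
    by (simp add: F_module_def fun_module_def)
  then show ?thesis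
    using module_Ff_module[OF assms(2)] ext_zero_module_morphism[OF assms(2)] ext_zero_inj_on[of M]
    by simp
qed

end
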